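(* Let $w$ be a word over a finite alphabet and let $1 \le i \le |w|/2$ be an integer. Then $w$ has a border of length $i$ if and only if $f(w)$ has an even palindromic prefix of order $i$, i.e., the prefix of $f(w)$ of length $2i$ is a palindrome.
   Context: For words $x = a_1\cdots a_n$, $y = b_1\cdots b_n$ of equal length, the perfect shuffle is $x \,\text{ш}\, y = a_1 b_1 a_2 b_2\cdots a_n b_n$. $w^R$ denotes the reverse of $w$; a palindrome is a word equal to its reverse, and a palindrome of length $n$ has order $\lfloor n/2\rfloor$. The map $f$ on words is defined by $f(x) = (y \,\text{ш}\, z^R)\,a$ where $x = yaz$ with $|y|=|z|$ and $a$ is empty if $|x|$ is even and a single letter if $|x|$ is odd. A border of $w$ is a word $u$ with $0<|u|<|w|$ that is both a prefix and a suffix of $w$. *)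

theory Defs
  imports Main "HOL-Library.Sublist"
begin

definition palindrome :: "'a list \<Rightarrow> bool" where
  "palindrome w \<longleftrightarrow> rev w = w"

definition pal_order :: "'a list \<Rightarrow> nat" where
  "pal_order w = length w div 2"

definition border :: "'a list \<Rightarrow> 'a list \<Rightarrow> bool" where
  "border u w \<longleftrightarrow> 0 < length u \<and> length u < length w \<and> prefix u w \<and> suffix u w"

text \<open>The perfect shuffle of two words of equal length is the library function \<open>splice\<close>:\<close>

lemma splice_nth:
  assumes "length x = length y" and "k < length x"
  shows "splice x y ! (2 * k) = x ! k" and "splice x y ! Suc (2 * k) = y ! k"
  using assms by (induction x y arbitrary: k rule: list_induct2) (auto simp: nth_Cons split: nat.splits)

text \<open>The middle factor \<open>a\<close> is empty or a single letter according to the parity of the length;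
  \<open>shuffle_map_eq\<close> recovers the description by a factorization \<open>x = y a z\<close>.\<close>

definition shuffle_map :: "'a list \<Rightarrow> 'a list" where
  "shuffle_map x =
    (let h = length x div 2;
         y = take h x;
         a = take (length x mod 2) (drop h x);
         z = drop (h + length x mod 2) x
     in splice y (rev z) @ a)"

lemma shuffle_map_eq:
  assumes "length y = length z" and "length a \<le> 1"
  shows "shuffle_map (y @ a @ z) = splice y (rev z) @ a"
proof (cases a)
  case Nil
  then show ?thesis using assms by (simp add: shuffle_map_def)
next
  case (Cons b bs)
  then have a: "a = [b]" using assms(2) by simp
  have h: "length (y @ a @ z) div 2 = length z" "length (y @ a @ z) mod 2 = 1"
    using a assms(1) by auto presburger
  show ?thesis unfolding shuffle_map_def h Let_def using a assms(1) by simp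
qed

end

theory Submission
  imports Defs
begin

text \<open>Interleaving satisfies \<open>rev (splice x y) = splice (rev y) (rev x)\<close> for words of equal length,
  so \<open>splice x y\<close> is a palindrome exactly when \<open>x = rev y\<close>. Applied to the first \<open>i\<close> letters of the
  two halves that \<open>shuffle_map\<close> interleaves, this compares the prefix of \<open>w\<close> of length \<open>i\<close> with the
  suffix of length \<open>i\<close>.\<close>

lemma splice_append:
  assumes "length a = length c"
  shows "splice (a @ b) (c @ d) = splice a c @ splice b d"
  using assms by (induction a c rule: list_induct2) auto

lemma rev_splice:
  assumes "length x = length y"
  shows "rev (splice x y) = splice (rev y) (rev x)"
  using assms by (induction x y rule: list_induct2) (auto simp: splice_append)

text \<open>With all lengths equal the letters alternate to the end, so the even and odd positions
  recover the two words.\<close>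

lemma splice_eq_iff:
  assumes "length a = length b" "length b = length c" "length c = length d"
  shows "splice a b = splice c d \<longleftrightarrow> a = c \<and> b = d"
  using assms by (induction a b c d rule: list_induct4) auto

lemma palindrome_splice_iff:
  assumes "length x = length y"
  shows "palindrome (splice x y) \<longleftrightarrow> x = rev y"
  using assms by (auto simp: palindrome_def rev_splice splice_eq_iff)

lemma take_splice:
  assumes "length x = length y" "i \<le> length x"
  shows "take (2 * i) (splice x y) = splice (take i x) (take i y)"
proof -
  \<comment> \<open>Both words are cut after \<open>i\<close> letters, so the first block has length
    exactly \<open>2 * i\<close>.\<close>
  have "splice x y = splice (take i x) (take i y) @ splice (drop i x) (drop i y)"
    using splice_append[of "take i x" "take i y" "drop i x" "drop i y"] assms by simp
  then show ?thesis using assms by simp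
qed

text \<open>The only candidate for \<open>u\<close> is \<open>take i w\<close>; the bounds on
  \<open>i\<close> make it nonempty and proper.\<close>

lemma ex_border_length_iff:
  assumes "0 < i" "i < length w"
  shows "(\<exists>u. border u w \<and> length u = i) \<longleftrightarrow> take i w = drop (length w - i) w"
proof
  assume "\<exists>u. border u w \<and> length u = i"
  then show "take i w = drop (length w - i) w"
  proof (elim exE conjE)
    fix u assume "border u w" "length u = i"
    then obtain s t where "w = u @ s" "w = t @ u"
      unfolding border_def prefix_def suffix_def by blast
    have "take i w = u"
      using \<open>length u = i\<close> \<open>w = u @ s\<close> by simp
    moreover have "drop (length w - i) w = u"
      using \<open>length u = i\<close> unfolding \<open>w = t @ u\<close> by simp
    ultimately show ?thesis by simp
  qed
next
  assume "take i w = drop (length w - i) w"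
  with assms show "\<exists>u. border u w \<and> length u = i"
    using take_is_prefix[of i w]
    by (intro exI[of _ "take i w"]) (simp add: border_def suffix_drop)
qed

text \<open>Since \<open>pal_order\<close> rounds down, it takes evenness as well as order
  \<open>i\<close> to force length \<open>2 * i\<close>; the assumption ensures that
  \<open>take\<close> really returns that many letters.\<close>

lemma ex_even_palindromic_prefix_iff:
  assumes "2 * i \<le> length v"
  shows "(\<exists>p. prefix p v \<and> palindrome p \<and> even (length p) \<and> pal_order p = i)
    \<longleftrightarrow> palindrome (take (2 * i) v)"
proof
  assume "\<exists>p. prefix p v \<and> palindrome p \<and> even (length p) \<and> pal_order p = i"
  then show "palindrome (take (2 * i) v)"
    by (auto simp: prefix_def pal_order_def)
next
  assume "palindrome (take (2 * i) v)"
  with assms show "\<exists>p. prefix p v \<and> palindrome p \<and> even (length p) \<and> pal_order p = i"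
    by (intro exI[of _ "take (2 * i) v"]) (simp add: pal_order_def take_is_prefix)
qed

theorem theorem2:
  fixes A :: "'a set" and w :: "'a list" and i :: nat
  assumes "finite A" and "w \<in> lists A"
    and "1 \<le> i" and "2 * i \<le> length w"
  shows "(\<exists>u. border u w \<and> length u = i) \<longleftrightarrow>
    (\<exists>p. prefix p (shuffle_map w) \<and> palindrome p \<and> even (length p) \<and> pal_order p = i)"
proof -
  define h where "h = length w div 2"
  define y where "y = take h w"
  define a where "a = take (length w mod 2) (drop h w)"
  define z where "z = drop (h + length w mod 2) w"
  have len: "length w = h + h + length w mod 2"
    unfolding h_def by presburger
  have w: "w = y @ a @ z"
    using append_take_drop_id[of h w] append_take_drop_id[of "length w mod 2" "drop h w"]
    unfolding y_def a_def z_def drop_drop by (simp only: add.commute)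
  have yz: "length y = h" "length z = h"
    using len by (simp_all add: y_def z_def)
  have i: "0 < i" "i \<le> h" "i < length w"
    using assms(3,4) by (auto simp: h_def)
  have f: "shuffle_map w = splice y (rev z) @ a"
    by (simp add: shuffle_map_def Let_def y_def a_def z_def h_def)
  \<comment> \<open>As \<open>i \<le> h\<close>, the prefix and the suffix of \<open>w\<close> of
    length \<open>i\<close> lie inside \<open>y\<close> and \<open>z\<close>, away from the middle
    \<open>a\<close>.\<close>
  have "(\<exists>u. border u w \<and> length u = i) \<longleftrightarrow> take i y = drop (h - i) z"
    using i yz by (simp add: ex_border_length_iff w)
  \<comment> \<open>The last \<open>i\<close> letters of \<open>z\<close>, read backwards, are the
    first \<open>i\<close> letters of \<open>rev z\<close>.\<close>
  also have "\<dots> \<longleftrightarrow> take i y = rev (take i (rev z))"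
    using yz by (simp add: take_rev)
  also have "\<dots> \<longleftrightarrow> palindrome (splice (take i y) (take i (rev z)))"
    using yz by (simp add: palindrome_splice_iff)
  \<comment> \<open>The shuffled part has length \<open>2 * h\<close>, so the prefix of length
    \<open>2 * i\<close> ends before \<open>a\<close>.\<close>
  also have "\<dots> \<longleftrightarrow> palindrome (take (2 * i) (shuffle_map w))"
    using i yz by (simp add: f take_splice)
  also have "\<dots> \<longleftrightarrow> (\<exists>p. prefix p (shuffle_map w) \<and> palindrome p \<and> even (length p) \<and> pal_order p = i)"
    using i yz by (intro ex_even_palindromic_prefix_iff[symmetric]) (simp add: f)
  finally show ?thesis .
qed

end
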